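(* Let $p$ be a prime, $n,m\ge 1$ integers, $F:\mathbb{F}_{p^n}\to\mathbb{F}_{p^m}$ any function, and fix $u\in\mathbb{F}_{p^n}$. The complete collection of profiles $\{\mathcal{L}_F(u,v):v\in\mathbb{F}_{p^m}^*\}$ (indexed by $v$) determines the $u$-th row $(\mathrm{DDT}_F(u,b))_{b\in\mathbb{F}_{p^m}}$ of the differential distribution table. More precisely, for every $b\in\mathbb{F}_{p^m}$, $$\mathrm{DDT}_F(u,b)=p^{n-m}+\frac1{p^m}\sum_{v\in\mathbb{F}_{p^m}^*}\zeta_p^{-\mathrm{Tr}_1^m(vb)}\sum_{j\in\mathbb{F}_p}L_F(u,v;j)\,\zeta_p^{j}.$$ Conversely, the $u$-th DDT row determines every profile $\mathcal{L}_F(u,v)$ through $$L_F(u,v;j)+p^{n-1}=\sum_{\substack{b\in\mathbb{F}_{p^m}\\ \mathrm{Tr}_1^m(vb)=j}}\mathrm{DDT}_F(u,b)\qquad(v\in\mathbb{F}_{p^m},\ j\in\mathbb{F}_p).$$ Hence, for fixed $u$, the DDT row and the complete family of profiles determine each other.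
   Context: $\zeta_p=e^{2\pi i/p}$; $\mathrm{Tr}_1^m$ is the absolute trace $\mathbb{F}_{p^m}\to\mathbb{F}_p$; $\mathbb{F}_{p^m}^*=\mathbb{F}_{p^m}\setminus\{0\}$. The derivative is $D_uF(x)=F(x+u)-F(x)$. The differential distribution table is $\mathrm{DDT}_F(u,b)=\#\{x\in\mathbb{F}_{p^n}:D_uF(x)=b\}$. The centered level count is $L_F(u,v;j)=\#\{x\in\mathbb{F}_{p^n}:\mathrm{Tr}_1^m(vD_uF(x))=j\}-p^{n-1}$ for $j\in\mathbb{F}_p$, and the profile at $(u,v)$ is $\mathcal{L}_F(u,v)=(L_F(u,v;j))_{j\in\mathbb{F}_p}$. *)

theory Defs
  imports
    Complex_Main
    "HOL-Computational_Algebra.Polynomial"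
    "Berlekamp_Zassenhaus.Finite_Field"
begin

text \<open>
  The prime field of order \<open>p\<close> is \<open>'p mod_ring\<close> with \<open>'p :: prime_card\<close> and \<open>p = CARD('p)\<close>.
  The fields of order \<open>p ^ n\<close> and \<open>p ^ m\<close> are types of class \<open>finite_field\<close> with the
  corresponding cardinality; the exponents are explicit parameters of the definitions below.
\<close>

text \<open>
  The embedding of the prime field into a field of characteristic \<open>p\<close>: a residue class is sent to
  the image of its representative in \<open>{0..<p}\<close>.
\<close>
definition prime_field_emb :: "'p :: prime_card mod_ring \<Rightarrow> 'b :: finite_field" where
  "prime_field_emb j = of_int (to_int_mod_ring j)"

text \<open>
  The sum of the conjugates of \<open>x\<close> is an element of the large field that lies in its prime subfield;
  the absolute trace is its preimage in \<open>'p mod_ring\<close>. Existence and uniqueness of the preimage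
  are shown in \<open>abs_trace_ex1\<close>.
\<close>
definition abs_trace :: "nat \<Rightarrow> 'b :: finite_field \<Rightarrow> 'p :: prime_card mod_ring" where
  "abs_trace m x = (THE j. prime_field_emb j = (\<Sum>i<m. x ^ (CARD('p) ^ i)))"

definition zeta :: "nat \<Rightarrow> complex" where
  "zeta p = exp (2 * of_real pi * \<i> / of_nat p)"

definition deriv_dir :: "('a :: finite_field \<Rightarrow> 'b :: finite_field) \<Rightarrow> 'a \<Rightarrow> 'a \<Rightarrow> 'b" where
  "deriv_dir F u x = F (x + u) - F x"

definition DDT :: "('a :: finite_field \<Rightarrow> 'b :: finite_field) \<Rightarrow> 'a \<Rightarrow> 'b \<Rightarrow> nat" where
  "DDT F u b = card {x. deriv_dir F u x = b}"

definition level_count ::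
  "nat \<Rightarrow> nat \<Rightarrow> ('a :: finite_field \<Rightarrow> 'b :: finite_field) \<Rightarrow> 'a \<Rightarrow> 'b \<Rightarrow> 'p :: prime_card mod_ring \<Rightarrow> int"
where
  "level_count n m F u v j =
     int (card {x. abs_trace m (v * deriv_dir F u x) = j}) - int (CARD('p) ^ (n - 1))"

definition profile ::
  "nat \<Rightarrow> nat \<Rightarrow> ('a :: finite_field \<Rightarrow> 'b :: finite_field) \<Rightarrow> 'a \<Rightarrow> 'b \<Rightarrow> ('p :: prime_card mod_ring \<Rightarrow> int)"
where
  "profile n m F u v = (\<lambda>j. level_count n m F u v j)"

lemma CHAR_eq_CARD_prime:
  assumes "CARD('b :: finite_field) = CARD('p :: prime_card) ^ m"
  shows "CHAR('b) = CARD('p)"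
proof -
  have "CHAR('b) dvd CARD('p) ^ m"
    using CHAR_dvd_CARD[where ?'a = 'b] assms by simp
  moreover have "prime CHAR('b)" by simp
  ultimately have "CHAR('b) dvd CARD('p)"
    using prime_dvd_power by blast
  then show ?thesis
    using \<open>prime CHAR('b)\<close> prime_card[where ?'a = 'p] primes_dvd_imp_eq by blast
qed

lemma inj_prime_field_emb:
  assumes "CARD('b :: finite_field) = CARD('p :: prime_card) ^ m"
  shows "inj (prime_field_emb :: 'p mod_ring \<Rightarrow> 'b)"
proof (rule injI)
  fix i j :: "'p mod_ring"
  assume "prime_field_emb i = (prime_field_emb j :: 'b)"
  then have "[to_int_mod_ring i = to_int_mod_ring j] (mod int CARD('p))"
    unfolding prime_field_emb_def of_int_eq_iff_cong_CHAR CHAR_eq_CARD_prime[OF assms] .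
  moreover have "to_int_mod_ring k \<in> {0..<int CARD('p)}" for k :: "'p mod_ring"
    using range_to_int_mod_ring[where ?'a = 'p] by blast
  ultimately have "to_int_mod_ring i = to_int_mod_ring j"
    by (metis atLeastLessThan_iff cong_less_imp_eq_int)
  then show "i = j"
    by (metis of_int_mod_ring_to_int_mod_ring)
qed

lemma range_prime_field_emb:
  assumes "CARD('b :: finite_field) = CARD('p :: prime_card) ^ m"
  shows "range (prime_field_emb :: 'p mod_ring \<Rightarrow> 'b) = {y. y ^ CARD('p) = y}"
proof -
  let ?p = "CARD('p)" and ?R = "range (prime_field_emb :: 'p mod_ring \<Rightarrow> 'b)"
  let ?q = "monom 1 ?p - monom 1 1 :: 'b poly"
  have p: "?p > 1" using prime_card[where ?'a = 'p] prime_gt_1_nat by blast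
  have char: "CHAR('b) = ?p" by (rule CHAR_eq_CARD_prime[OF assms])
  have nat_fix: "(of_nat k :: 'b) ^ ?p = of_nat k" for k
  proof (induction k)
    case 0
    then show ?case using p by simp
  next
    case (Suc k)
    have "(1 + of_nat k :: 'b) ^ ?p = 1 ^ ?p + of_nat k ^ ?p"
      by (rule freshmans_dream) (simp_all only: char prime_card)
    then show ?case by (simp only: of_nat_Suc Suc.IH power_one)
  qed
  have sub: "?R \<subseteq> {y. y ^ ?p = y}"
  proof safe
    fix j :: "'p mod_ring"
    have "0 \<le> to_int_mod_ring j"
      using range_to_int_mod_ring[where ?'a = 'p] by (metis atLeastLessThan_iff rangeI)
    then obtain k where "to_int_mod_ring j = int k" using nonneg_int_cases by blast
    then show "(prime_field_emb j :: 'b) ^ ?p = prime_field_emb j"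
      by (simp add: prime_field_emb_def nat_fix)
  qed
  have "coeff ?q ?p = 1" using p by simp
  then have "?q \<noteq> 0" by (metis coeff_0 zero_neq_one)
  then have "card {y. poly ?q y = 0} \<le> degree ?q" by (rule card_poly_roots_bound)
  also have "degree ?q \<le> ?p"
    using p by (intro degree_diff_le) (auto simp: degree_monom_eq)
  also have "{y. poly ?q y = 0} = {y. y ^ ?p = y}" by (simp add: poly_monom)
  finally have "card {y :: 'b. y ^ ?p = y} \<le> ?p" .
  moreover have "card ?R = ?p"
    using card_image[OF inj_prime_field_emb[OF assms]] by simp
  ultimately show ?thesis
    using sub card_mono[OF finite sub] by (intro card_subset_eq) simp_all
qed

lemma abs_trace_ex1:
  fixes x :: "'b :: finite_field"
  assumes "CARD('b) = CARD('p :: prime_card) ^ m"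
  shows "\<exists>!j :: 'p mod_ring. prime_field_emb j = (\<Sum>i<m. x ^ (CARD('p) ^ i))"
proof -
  let ?p = "CARD('p)" and ?s = "\<Sum>i<m. x ^ (CARD('p) ^ i)"
  have xm: "x ^ (?p ^ m) = x"
    using finite_field_power_card_eq_same[of x] assms by simp
  have "?s ^ ?p = (\<Sum>i<m. (x ^ (?p ^ i)) ^ ?p)"
    by (rule freshmans_dream_sum) (simp_all add: CHAR_eq_CARD_prime[OF assms] prime_card)
  also have "\<dots> = (\<Sum>i<m. x ^ (?p ^ Suc i))"
    by (simp add: power_mult[symmetric] mult.commute)
  also have "\<dots> = ?s"
    using sum.lessThan_Suc_shift[of "\<lambda>i. x ^ (?p ^ i)" m] xm by simp
  finally have "?s \<in> range (prime_field_emb :: 'p mod_ring \<Rightarrow> 'b)"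
    unfolding range_prime_field_emb[OF assms] by simp
  then show ?thesis
    using inj_prime_field_emb[OF assms] by (metis injD rangeE)
qed

lemma prime_field_emb_abs_trace:
  fixes x :: "'b :: finite_field"
  assumes "CARD('b) = CARD('p :: prime_card) ^ m"
  shows "prime_field_emb (abs_trace m x :: 'p mod_ring) = (\<Sum>i<m. x ^ (CARD('p) ^ i))"
  unfolding abs_trace_def by (rule theI'[OF abs_trace_ex1[OF assms]])

end

theory Submission
  imports Defs "HOL-Library.Real_Mod"
begin

text \<open>
  Composing the absolute trace with \<open>j \<mapsto> \<zeta>\<^sub>p\<^sup>j\<close> gives an additive character \<open>\<chi>\<close> of the field of order
  \<open>p\<^sup>m\<close>. It is nontrivial because the trace is a polynomial of degree \<open>p\<^sup>m\<^sup>-\<^sup>1\<close>, which cannot vanish at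
  \<open>p\<^sup>m\<close> points. The inner sum of the inversion formula is \<open>\<Sum>\<^sub>x \<chi> (v D\<^sub>uF(x))\<close>, the shift by
  \<open>p\<^sup>n\<^sup>-\<^sup>1\<close> disappearing because the \<open>p\<close>-th roots of unity sum to 0; orthogonality of the characters
  \<open>x \<mapsto> \<chi> (v x)\<close> then isolates the \<open>x\<close> with \<open>D\<^sub>uF(x) = b\<close>, and the term \<open>v = 0\<close> contributes
  \<open>p\<^sup>n\<close>.
\<close>

text \<open>Translation by \<open>a\<close> permutes the group, so the sum is unchanged by
  multiplication with \<open>\<chi> a\<close>; since \<chi> takes values in a domain,
  \<open>\<chi> a \<noteq> 1\<close> forces it to be 0.\<close>

lemma sum_additive_character:
  fixes \<chi> :: "'a :: {finite, ab_group_add} \<Rightarrow> 'c :: idom"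
  assumes "\<And>x y. \<chi> (x + y) = \<chi> x * \<chi> y" and "\<chi> a \<noteq> 1"
  shows "(\<Sum>x\<in>UNIV. \<chi> x) = 0"
proof -
  have "(\<Sum>x\<in>UNIV. \<chi> x) = (\<Sum>x\<in>UNIV. \<chi> (a + x))"
    by (rule sum.reindex_bij_witness[of _ "\<lambda>x. a + x" "\<lambda>x. x - a"]) auto
  also have "\<dots> = \<chi> a * (\<Sum>x\<in>UNIV. \<chi> x)"
    by (simp add: assms(1) sum_distrib_left)
  finally show ?thesis using assms(2) by (simp add: algebra_simps)
qed

section \<open>Additivity and nontriviality of the absolute trace\<close>

lemma to_int_mod_ring_add:
  "to_int_mod_ring (a + b :: 'p :: prime_card mod_ring) =
     (to_int_mod_ring a + to_int_mod_ring b) mod int CARD('p)"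
  by transfer simp

text \<open>Adding representatives may wrap around modulo \<open>CARD('p)\<close>, which is
  invisible in a field of that characteristic.\<close>

lemma prime_field_emb_add:
  fixes a b :: "'p :: prime_card mod_ring"
  assumes "CARD('b :: finite_field) = CARD('p) ^ m"
  shows "(prime_field_emb (a + b) :: 'b) = prime_field_emb a + prime_field_emb b"
  unfolding prime_field_emb_def to_int_mod_ring_add of_int_add[symmetric]
    of_int_eq_iff_cong_CHAR CHAR_eq_CARD_prime[OF assms] by (simp add: cong_def)

text \<open>Iterated Frobenius maps are additive, hence so is the sum of conjugates; injectivity of
  the embedding pulls this back to the prime field.\<close>

lemma abs_trace_add:
  fixes x y :: "'b :: finite_field"
  assumes "CARD('b) = CARD('p :: prime_card) ^ m"
  shows "(abs_trace m (x + y) :: 'p mod_ring) = abs_trace m x + abs_trace m y"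
proof -
  have dream: "(x + y) ^ (CARD('p) ^ i) = x ^ (CARD('p) ^ i) + y ^ (CARD('p) ^ i)" for i
    by (rule freshmans_dream') (simp_all add: CHAR_eq_CARD_prime[OF assms] prime_card)
  have "(prime_field_emb (abs_trace m (x + y) :: 'p mod_ring) :: 'b) =
          prime_field_emb (abs_trace m x + abs_trace m y :: 'p mod_ring)"
    by (simp only: prime_field_emb_add[OF assms] prime_field_emb_abs_trace[OF assms] dream
        sum.distrib)
  then show ?thesis using inj_prime_field_emb[OF assms] by (simp add: inj_eq)
qed

lemma abs_trace_diff:
  fixes x y :: "'b :: finite_field"
  assumes "CARD('b) = CARD('p :: prime_card) ^ m"
  shows "(abs_trace m (x - y) :: 'p mod_ring) = abs_trace m x - abs_trace m y"
  using abs_trace_add[OF assms, of "x - y" y] by (simp add: algebra_simps)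

lemma abs_trace_nontrivial:
  assumes "CARD('b :: finite_field) = CARD('p :: prime_card) ^ m" and "m \<ge> 1"
  shows "\<exists>x :: 'b. (abs_trace m x :: 'p mod_ring) \<noteq> 0"
proof (rule ccontr)
  assume "\<not> ?thesis"
  then have "(\<Sum>i<m. x ^ (CARD('p) ^ i)) = 0" for x :: 'b
    using prime_field_emb_abs_trace[OF assms(1), of x] by (simp add: prime_field_emb_def)
  moreover define q :: "'b poly" where "q = (\<Sum>i<m. monom 1 (CARD('p) ^ i))"
  ultimately have roots: "{x. poly q x = 0} = UNIV"
    by (simp add: poly_sum poly_monom)
  have p: "CARD('p) > 1" using prime_card[where ?'a = 'p] prime_gt_1_nat by blast
  \<comment> \<open>Because \<open>CARD('p) > 1\<close>, the exponent \<open>CARD('p) ^ i\<close>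
    equals 1 only for \<open>i = 0\<close>, an index that occurs since
    \<open>m \<ge> 1\<close>.\<close>
  then have "coeff q 1 = (\<Sum>i<m. if i = 0 then 1 else 0)"
    unfolding q_def coeff_sum by (intro sum.cong) auto
  then have "coeff q 1 = 1" using assms(2) by simp
  then have "q \<noteq> 0" by auto
  then have "CARD('b) \<le> degree q" using card_poly_roots_bound[of q] roots by simp
  also have "\<dots> \<le> CARD('p) ^ (m - 1)"
    unfolding q_def using p
    by (intro degree_sum_le) (auto simp: degree_monom_eq intro!: power_increasing)
  also have "\<dots> < CARD('p) ^ m" using p assms(2) by (intro power_strict_increasing) auto
  finally show False using assms(1) by simp
qed

section \<open>Roots of unity and orthogonality of characters\<close>

lemma zeta_eq_cis: "zeta p = cis (2 * pi / real p)"
  by (simp add: zeta_def cis_conv_exp mult_ac)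

lemma zeta_nonzero [simp]: "zeta p \<noteq> 0"
  by (simp add: zeta_def)

lemma zeta_powi_eq_1_iff:
  assumes "p > 0"
  shows "zeta p powi k = 1 \<longleftrightarrow> int p dvd k"
proof -
  have "zeta p powi k = 1 \<longleftrightarrow> (\<exists>l. real_of_int k = real_of_int (int p * l))"
    unfolding zeta_eq_cis cis_power_int cis_eq_1_iff using assms by (simp add: field_simps)
  then show ?thesis unfolding of_int_eq_iff dvd_def .
qed

lemma zeta_powi_mod:
  assumes "p > 0"
  shows "zeta p powi (k mod int p) = zeta p powi k"
proof -
  have "zeta p powi (int p * (k div int p) + k mod int p) = zeta p powi (k mod int p)"
    using assms by (subst power_int_add) (auto simp: zeta_powi_eq_1_iff)
  then show ?thesis by simp
qed

definition prime_character :: "'p :: prime_card mod_ring \<Rightarrow> complex" where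
  "prime_character j = zeta CARD('p) powi to_int_mod_ring j"

lemma prime_character_add:
  "prime_character (i + j) = prime_character i * prime_character (j :: 'p :: prime_card mod_ring)"
  by (simp add: prime_character_def to_int_mod_ring_add zeta_powi_mod power_int_add)

lemma prime_character_0 [simp]: "prime_character 0 = 1"
  by (simp add: prime_character_def)

text \<open>The representative of \<open>- j\<close> is not the negated representative of
  \<open>j\<close> unless \<open>j = 0\<close>. This bridges to the negative exponent in the
  inversion formula.\<close>

lemma prime_character_minus:
  "prime_character (- j) = zeta CARD('p) powi (- to_int_mod_ring (j :: 'p :: prime_card mod_ring))"
proof -
  have "prime_character (- j) * prime_character j = 1"
    by (simp add: prime_character_add[symmetric])
  then show ?thesis
    by (simp add: prime_character_def power_int_minus field_simps)
qed

lemma prime_character_eq_1_iff: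
  "prime_character j = 1 \<longleftrightarrow> j = (0 :: 'p :: prime_card mod_ring)"
proof
  have "to_int_mod_ring j \<in> {0..<int CARD('p)}"
    using range_to_int_mod_ring[where ?'a = 'p] by blast
  moreover assume "prime_character j = 1"
  then have "int CARD('p) dvd to_int_mod_ring j"
    by (simp add: prime_character_def zeta_powi_eq_1_iff)
  ultimately have "to_int_mod_ring j = 0"
    using zdvd_not_zless by force
  then show "j = 0" by simp
qed simp

lemma sum_prime_character: "(\<Sum>j\<in>UNIV. prime_character (j :: 'p :: prime_card mod_ring)) = 0"
  by (rule sum_additive_character[of _ 1]) (simp_all add: prime_character_add
      prime_character_eq_1_iff)

lemma sum_prime_character_abs_trace:
  fixes c :: "'b :: finite_field"
  assumes "CARD('b) = CARD('p :: prime_card) ^ m" and "m \<ge> 1"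
  shows "(\<Sum>v\<in>UNIV. prime_character (abs_trace m (v * c) :: 'p mod_ring)) =
           (if c = 0 then of_nat CARD('p) ^ m else 0)"
proof (cases "c = 0")
  case True
  then show ?thesis using abs_trace_diff[OF assms(1), of 0 0] assms(1) by simp
next
  case False
  obtain x :: 'b where "(abs_trace m x :: 'p mod_ring) \<noteq> 0"
    using abs_trace_nontrivial[OF assms] by blast
  \<comment> \<open>The witness \<open>x / c\<close> is chosen so that multiplication by
    \<open>c\<close> returns \<open>x\<close>, a point of nonzero trace.\<close>
  then have "prime_character (abs_trace m (x / c * c) :: 'p mod_ring) \<noteq> 1"
    using False by (simp add: prime_character_eq_1_iff)
  moreover have "prime_character (abs_trace m ((v + w) * c) :: 'p mod_ring) =
      prime_character (abs_trace m (v * c) :: 'p mod_ring) *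
      prime_character (abs_trace m (w * c) :: 'p mod_ring)" for v w
    by (simp add: distrib_right abs_trace_add[OF assms(1)] prime_character_add)
  ultimately show ?thesis
    using False
      sum_additive_character[of "\<lambda>v. prime_character (abs_trace m (v * c) :: 'p mod_ring)" "x / c"]
    by simp
qed

section \<open>Level counts, the inversion formula and its converse\<close>

lemma sum_card_fibre:
  fixes f :: "'a :: finite \<Rightarrow> 'b :: finite" and g :: "'b \<Rightarrow> 'c :: comm_semiring_1"
  shows "(\<Sum>j\<in>UNIV. of_nat (card {x. f x = j}) * g j) = (\<Sum>x\<in>UNIV. g (f x))"
proof -
  have "(\<Sum>x\<in>UNIV. g (f x)) = (\<Sum>j\<in>UNIV. \<Sum>x | f x = j. g (f x))"
    using sum.group[of UNIV UNIV f "\<lambda>x. g (f x)"] by simp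
  also have "\<dots> = (\<Sum>j\<in>UNIV. of_nat (card {x. f x = j}) * g j)"
    by (intro sum.cong) auto
  finally show ?thesis by simp
qed

lemma sum_level_count_character:
  "(\<Sum>j\<in>UNIV. of_int (level_count n m F u v j) * prime_character (j :: 'p :: prime_card mod_ring)) =
     (\<Sum>x\<in>UNIV. prime_character (abs_trace m (v * deriv_dir F u x) :: 'p mod_ring))"
  unfolding level_count_def
  by (simp add: left_diff_distrib sum_subtractf sum_distrib_left[symmetric] sum_prime_character
      sum_card_fibre)

lemma DDT_inversion:
  fixes F :: "'a :: finite_field \<Rightarrow> 'b :: finite_field"
  assumes "CARD('b) = CARD('p :: prime_card) ^ m" and "m \<ge> 1" and "CARD('a) = CARD('p) ^ n"
  shows "of_nat (DDT F u b) = of_nat CARD('p) powi (int n - int m) +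
      1 / of_nat CARD('p) ^ m *
        (\<Sum>v \<in> UNIV - {0}.
           zeta CARD('p) powi (- to_int_mod_ring (abs_trace m (v * b) :: 'p mod_ring)) *
           (\<Sum>j \<in> (UNIV :: 'p mod_ring set).
              of_int (level_count n m F u v j) * zeta CARD('p) powi (to_int_mod_ring j)))"
proof -
  let ?tr = "abs_trace m :: 'b \<Rightarrow> 'p mod_ring" and ?q = "of_nat CARD('p) :: complex"
  \<comment> \<open>\<open>S\<close> is also defined at 0, so that orthogonality can be applied over
    the whole field before this term is split off.\<close>
  define S where "S v = prime_character (- ?tr (v * b)) *
    (\<Sum>j\<in>(UNIV :: 'p mod_ring set). of_int (level_count n m F u v j) * prime_character j)" for v
  have tr_diff: "?tr (x - y) = ?tr x - ?tr y" for x y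
    by (rule abs_trace_diff[OF assms(1)])
  have tr0: "?tr 0 = 0" using tr_diff[of 0 0] by simp
  have "S v = (\<Sum>x\<in>UNIV. prime_character (?tr (v * (deriv_dir F u x - b))))" for v
    unfolding S_def sum_level_count_character
    by (simp add: sum_distrib_left prime_character_add[symmetric] right_diff_distrib tr_diff)
  then have "(\<Sum>v\<in>UNIV. S v) =
      (\<Sum>x\<in>UNIV. \<Sum>v\<in>UNIV. prime_character (?tr (v * (deriv_dir F u x - b))))"
    by (simp add: sum.swap[where A = "UNIV :: 'b set"])
  also have "\<dots> = (\<Sum>x\<in>UNIV. if deriv_dir F u x = b then ?q ^ m else 0)"
    unfolding sum_prime_character_abs_trace[OF assms(1,2)] by simp
  also have "\<dots> = of_nat (DDT F u b) * ?q ^ m"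
    by (simp add: DDT_def sum.If_cases)
  finally have total: "(\<Sum>v\<in>UNIV. S v) = of_nat (DDT F u b) * ?q ^ m" .
  \<comment> \<open>At \<open>v = 0\<close> every trace is 0, so each of the \<open>CARD('a)\<close>
    points contributes 1.\<close>
  have "S 0 = ?q ^ n"
    unfolding S_def sum_level_count_character by (simp add: tr0 assms(3))
  then have "(\<Sum>v\<in>UNIV - {0}. S v) = of_nat (DDT F u b) * ?q ^ m - ?q ^ n"
    using total by (simp add: sum_diff1)
  then have "of_nat (DDT F u b) = ?q powi (int n - int m) + 1 / ?q ^ m * (\<Sum>v\<in>UNIV - {0}. S v)"
    by (simp add: power_int_diff field_simps)
  \<comment> \<open>The negated arguments have to be rewritten first, while
    \<open>prime_character\<close> is still folded.\<close>
  then show ?thesis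
    unfolding S_def prime_character_minus unfolding prime_character_def .
qed

text \<open>The condition on \<open>x\<close> depends only on the value \<open>b\<close> of the
  derivative, so the points can be grouped by \<open>b\<close>, with the indicator of the trace
  condition as weight.\<close>

lemma level_count_eq_sum_DDT:
  "level_count n m F u v (j :: 'p :: prime_card mod_ring) + int (CARD('p) ^ (n - 1)) =
     (\<Sum>b | abs_trace m (v * b) = j. int (DDT F u b))"
proof -
  have "int (card {x. abs_trace m (v * deriv_dir F u x) = j}) =
      (\<Sum>x\<in>UNIV. if abs_trace m (v * deriv_dir F u x) = j then 1 else 0)"
    by (simp add: sum.If_cases)
  also have "\<dots> = (\<Sum>b\<in>UNIV. int (DDT F u b) * (if abs_trace m (v * b) = j then 1 else 0))"
    unfolding DDT_def by (rule sum_card_fibre[symmetric])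
  also have "\<dots> = (\<Sum>b | abs_trace m (v * b) = j. int (DDT F u b))"
    by (simp add: if_distrib sum.If_cases cong: if_cong)
  finally show ?thesis by (simp add: level_count_def)
qed

theorem theorem4p2:
  fixes F :: "'a :: finite_field \<Rightarrow> 'b :: finite_field"
    and u :: 'a
    and p n m :: nat
  assumes "p = CARD('p :: prime_card)"
    and "n \<ge> 1" and "m \<ge> 1"
    and "CARD('a) = p ^ n" and "CARD('b) = p ^ m"
  shows
    "(\<forall>b. of_nat (DDT F u b) =
        of_nat p powi (int n - int m) +
        1 / of_nat p ^ m *
          (\<Sum>v \<in> UNIV - {0}.
             zeta p powi (- to_int_mod_ring (abs_trace m (v * b) :: 'p mod_ring)) *
             (\<Sum>j \<in> (UNIV :: 'p mod_ring set).
                of_int (level_count n m F u v j) * zeta p powi (to_int_mod_ring j))))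
     \<and>
     (\<forall>v. \<forall>j :: 'p mod_ring.
        level_count n m F u v j + int (p ^ (n - 1)) =
        (\<Sum>b | abs_trace m (v * b) = j. int (DDT F u b)))
     \<and>
     (\<forall>G :: 'a \<Rightarrow> 'b.
        (\<forall>v. v \<noteq> 0 \<longrightarrow> (profile n m F u v :: 'p mod_ring \<Rightarrow> int) = profile n m G u v)
        \<longrightarrow> (\<forall>b. DDT F u b = DDT G u b))
     \<and>
     (\<forall>G :: 'a \<Rightarrow> 'b.
        (\<forall>b. DDT F u b = DDT G u b)
        \<longrightarrow> (\<forall>v. (profile n m F u v :: 'p mod_ring \<Rightarrow> int) = profile n m G u v))"
proof -
  note p = assms(1)
  \<comment> \<open>Both formulas are stated for an arbitrary \<open>G\<close>, to be applied to the
    two functions being compared.\<close>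
  have inversion: "of_nat (DDT G u b) =
        of_nat p powi (int n - int m) +
        1 / of_nat p ^ m *
          (\<Sum>v \<in> UNIV - {0}.
             zeta p powi (- to_int_mod_ring (abs_trace m (v * b) :: 'p mod_ring)) *
             (\<Sum>j \<in> (UNIV :: 'p mod_ring set).
                of_int (level_count n m G u v j) * zeta p powi (to_int_mod_ring j)))"
    for G :: "'a \<Rightarrow> 'b" and b
    unfolding p using assms by (intro DDT_inversion) simp_all
  have levels: "level_count n m G u v j + int (p ^ (n - 1)) =
        (\<Sum>b | abs_trace m (v * b) = j. int (DDT G u b))"
    for G :: "'a \<Rightarrow> 'b" and v and j :: "'p mod_ring"
    unfolding p by (rule level_count_eq_sum_DDT)
  have "DDT F u b = DDT G u b"
    if eq: "\<forall>v. v \<noteq> 0 \<longrightarrow> (profile n m F u v :: 'p mod_ring \<Rightarrow> int) = profile n m G u v"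
    for G :: "'a \<Rightarrow> 'b" and b
  proof -
    have "level_count n m F u v j = level_count n m G u v j" if "v \<noteq> 0"
      for v and j :: "'p mod_ring"
      using eq that unfolding profile_def by metis
    \<comment> \<open>The right-hand side of the inversion formula depends on the function only
      through level counts at nonzero \<open>v\<close>; injectivity of the cast to the complex
      numbers then gives equality of the natural numbers.\<close>
    then have "complex_of_nat (DDT F u b) = of_nat (DDT G u b)"
      unfolding inversion by (intro arg_cong2[of _ _ _ _ "(+)"] arg_cong2[of _ _ _ _ "(*)"]
          refl sum.cong) auto
    then show ?thesis by simp
  qed
  moreover have "(profile n m F u v :: 'p mod_ring \<Rightarrow> int) = profile n m G u v"
    if "\<forall>b. DDT F u b = DDT G u b" for G :: "'a \<Rightarrow> 'b" and v
    unfolding profile_def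
  proof
    fix j :: "'p mod_ring"
    show "level_count n m F u v j = level_count n m G u v j"
      using levels[of F v j] levels[of G v j] that by simp
  qed
  ultimately show ?thesis using inversion[of F] levels[of F] by blast
qed

end
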